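(* Let $f:\mathbb{D}\to\mathbb{D}$ be analytic with $\mathbb{A}_H(f(\mathbb{D}))<\infty$. For any $\theta\in\mathbb{R}$ and $\rho_0>0$, let $L_H(\rho_0)=\int_0^{\rho_0}\|f'(\gamma(t))\|_{H\to H}\,dt$, where $\gamma(t)=\tanh(\frac{t}{2})e^{i\theta}$; this is the hyperbolic length of the image under $f$ of the radial segment $[0,\tanh(\frac{\rho_0}{2})e^{i\theta}]$, which has hyperbolic length $\rho_0$. Then $$L_H(\rho_0)=o(\rho_0^{1/2})\quad\text{as }\rho_0\to\infty.$$
   Context: $\mathbb{D}=\{|z|<1\}$ carries the hyperbolic metric with density $\lambda_H(z)=2/(1-|z|^2)$. $\|f'(z)\|_{H\to H}=|f'(z)|\lambda_H(f(z))/\lambda_H(z)$. $\mathbb{A}_H(f(\mathbb{D}))=\int_{\mathbb{D}}|f'(z)|^2\lambda_H(f(z))^2\,dx\,dy$ is the hyperbolic area of the image counting multiplicity. *)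

theory Defs
  imports "HOL-Analysis.Analysis" "HOL-Library.Landau_Symbols"
begin

definition lambda_H :: "complex \<Rightarrow> real" where
  "lambda_H z = 2 / (1 - (cmod z)\<^sup>2)"

definition hyp_deriv_norm :: "(complex \<Rightarrow> complex) \<Rightarrow> complex \<Rightarrow> real" where
  "hyp_deriv_norm f z = cmod (deriv f z) * lambda_H (f z) / lambda_H z"

text \<open>Hyperbolic area of the image f(D), counting multiplicity (value in [0,\<infinity>]).\<close>
definition hyp_area_image :: "(complex \<Rightarrow> complex) \<Rightarrow> ennreal" where
  "hyp_area_image f =
     (\<integral>\<^sup>+ z. ennreal ((cmod (deriv f z))\<^sup>2 * (lambda_H (f z))\<^sup>2) * indicator (ball 0 1) z \<partial>lborel)"

text \<open>Hyperbolic length of the image under f of the radial segment of hyperbolic length rho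
  in direction theta.\<close>
definition L_H :: "(complex \<Rightarrow> complex) \<Rightarrow> real \<Rightarrow> real \<Rightarrow> real" where
  "L_H f \<theta> \<rho> = integral {0..\<rho>} (\<lambda>t. hyp_deriv_norm f (complex_of_real (tanh (t/2)) * cis \<theta>))"

end

theory Submission
  imports Defs "HOL-Complex_Analysis.Complex_Analysis"
begin

text \<open>With \<open>u = |f'|\<^sup>2 \<lambda>(f)\<^sup>2\<close> and \<open>g = \<parallel>f'\<parallel>\<close> the hyperbolic derivative, \<open>g\<^sup>2 = u / \<lambda>\<^sup>2\<close>, and \<open>u\<close> has the
  sub-mean value property on discs. Applied to the discs \<open>B\<^sub>t\<close> of radius \<open>(1 - |\<gamma>(t)|)/2\<close> around
  \<open>\<gamma>(t)\<close>, it bounds \<open>g(\<gamma>(t))\<^sup>2\<close> by a constant times the integral of \<open>u\<close> over \<open>B\<^sub>t\<close>. A given point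
  lies in \<open>B\<^sub>t\<close> only for a set of times \<open>t\<close> of bounded diameter, so Fubini bounds the integral of
  \<open>g(\<gamma>(t))\<^sup>2\<close> over \<open>[0, \<infinity>)\<close> by a multiple of the hyperbolic area. The claim follows by the
  Cauchy-Schwarz inequality applied to the tail of this convergent integral.\<close>

section \<open>Planar Lebesgue measure: Fubini, shears, rotations\<close>

text \<open>Lebesgue measure is determined by its values on boxes, and a complex box is a product of
  two intervals. This opens the plane to Fubini in the real and imaginary parts.\<close>

lemma lborel_complex_eq:
  "(lborel :: complex measure) =
     distr (lborel \<Otimes>\<^sub>M lborel) borel (\<lambda>(x, y). complex_of_real x + \<i> * complex_of_real y)"
proof (rule lborel_eqI)
  fix l u :: complex
  assume lu: "\<And>b. b \<in> Basis \<Longrightarrow> l \<bullet> b \<le> u \<bullet> b"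
  have le: "Re l \<le> Re u" "Im l \<le> Im u"
    using lu[of 1] lu[of \<i>] by (auto simp: Basis_complex_def)
  have "(\<lambda>(x, y). complex_of_real x + \<i> * complex_of_real y) -` box l u \<inter>
      space (lborel \<Otimes>\<^sub>M lborel) = box (Re l) (Re u) \<times> box (Im l) (Im u)"
    by (auto simp: box_def Basis_complex_def space_pair_measure)
  then show "emeasure (distr (lborel \<Otimes>\<^sub>M lborel) borel
      (\<lambda>(x, y). complex_of_real x + \<i> * complex_of_real y)) (box l u) =
      ennreal (\<Prod>b\<in>Basis. (u - l) \<bullet> b)"
    using le by (subst emeasure_distr)
      (auto simp: lborel.emeasure_pair_measure_Times Basis_complex_def ennreal_mult
          emeasure_lborel_box_eq)
qed simp

lemma nn_integral_lborel_complex: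
  fixes F :: "complex \<Rightarrow> ennreal"
  assumes [measurable]: "F \<in> borel_measurable borel"
  shows "(\<integral>\<^sup>+z. F z \<partial>lborel) = (\<integral>\<^sup>+x. \<integral>\<^sup>+y. F (of_real x + \<i> * of_real y) \<partial>lborel \<partial>lborel)"
    and "(\<integral>\<^sup>+z. F z \<partial>lborel) = (\<integral>\<^sup>+y. \<integral>\<^sup>+x. F (of_real x + \<i> * of_real y) \<partial>lborel \<partial>lborel)"
proof -
  show *: "(\<integral>\<^sup>+z. F z \<partial>lborel) = (\<integral>\<^sup>+x. \<integral>\<^sup>+y. F (of_real x + \<i> * of_real y) \<partial>lborel \<partial>lborel)"
    by (subst lborel_complex_eq, subst nn_integral_distr)
      (auto simp: lborel.nn_integral_fst[symmetric] split_beta')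
  show "(\<integral>\<^sup>+z. F z \<partial>lborel) = (\<integral>\<^sup>+y. \<integral>\<^sup>+x. F (of_real x + \<i> * of_real y) \<partial>lborel \<partial>lborel)"
    unfolding * by (rule lborel_pair.Fubini'[symmetric]) measurable
qed

lemma nn_integral_lborel_translation:
  fixes F :: "'a::euclidean_space \<Rightarrow> ennreal"
  assumes [measurable]: "F \<in> borel_measurable borel"
  shows "(\<integral>\<^sup>+x. F (c + x) \<partial>lborel) = (\<integral>\<^sup>+x. F x \<partial>lborel)"
  by (subst (2) lborel_distr_plus[of c, symmetric], subst nn_integral_distr) auto

lemma nn_integral_shear_Re:
  fixes F :: "complex \<Rightarrow> ennreal"
  assumes [measurable]: "F \<in> borel_measurable borel"
  shows "(\<integral>\<^sup>+z. F (z + of_real (a * Im z)) \<partial>lborel) = (\<integral>\<^sup>+z. F z \<partial>lborel)"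
proof -
  have "(\<integral>\<^sup>+x. F (of_real x + \<i> * of_real y + of_real (a * y)) \<partial>lborel) =
      (\<integral>\<^sup>+x. F (of_real x + \<i> * of_real y) \<partial>lborel)" for y
    using nn_integral_lborel_translation[of "\<lambda>x. F (of_real x + \<i> * of_real y)" "a * y"]
    by (simp add: algebra_simps)
  then show ?thesis
    by (simp add: nn_integral_lborel_complex(2) cong: nn_integral_cong)
qed

lemma nn_integral_shear_Im:
  fixes F :: "complex \<Rightarrow> ennreal"
  assumes [measurable]: "F \<in> borel_measurable borel"
  shows "(\<integral>\<^sup>+z. F (z + \<i> * of_real (a * Re z)) \<partial>lborel) = (\<integral>\<^sup>+z. F z \<partial>lborel)"
proof -
  have "(\<integral>\<^sup>+y. F (of_real x + \<i> * of_real y + \<i> * of_real (a * x)) \<partial>lborel) =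
      (\<integral>\<^sup>+y. F (of_real x + \<i> * of_real y) \<partial>lborel)" for x
    using nn_integral_lborel_translation[of "\<lambda>y. F (of_real x + \<i> * of_real y)" "a * x"]
    by (simp add: algebra_simps)
  then show ?thesis
    by (simp add: nn_integral_lborel_complex(1) cong: nn_integral_cong)
qed

text \<open>A rotation by an angle other than \<open>\<pi>\<close> is a product of three shears, each of which
  preserves area by translation invariance in one variable.\<close>

lemma nn_integral_rotation:
  fixes F :: "complex \<Rightarrow> ennreal"
  assumes F: "F \<in> borel_measurable borel" and c: "cmod c = 1"
  shows "(\<integral>\<^sup>+z. F (c * z) \<partial>lborel) = (\<integral>\<^sup>+z. F z \<partial>lborel)"
proof -
  have rot: "(\<integral>\<^sup>+z. G (c * z) \<partial>lborel) = (\<integral>\<^sup>+z. G z \<partial>lborel)"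
    if [measurable]: "G \<in> borel_measurable borel" and c: "cmod c = 1" "c \<noteq> -1" for G c
  proof -
    \<comment> \<open>For \<open>c\<close> = exp(i\<phi>) this is -tan(\<phi>/2), the value for
      which the shears \<open>X\<close>, \<open>Y\<close>, \<open>X\<close> compose to the rotation
      by \<phi>. It is undefined only at \<phi> = \<pi>.\<close>
    define t where "t = - Im c / (1 + Re c)"
    define X where "X z = z + complex_of_real (t * Im z)" for z
    define Y where "Y z = z + \<i> * complex_of_real (Im c * Re z)" for z
    have [measurable]: "X \<in> borel_measurable borel" "Y \<in> borel_measurable borel"
      unfolding X_def Y_def by measurable
    have sq: "(Re c)\<^sup>2 + (Im c)\<^sup>2 = 1"
      using c(1) by (simp add: cmod_def)
    have "1 + Re c \<noteq> 0"
    proof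
      assume "1 + Re c = 0"
      then have "Re c = -1" by simp
      with sq have "Im c = 0" by simp
      with \<open>Re c = -1\<close> c(2) show False by (simp add: complex_eq_iff)
    qed
    then have t: "t * (1 + Re c) = - Im c" by (simp add: t_def)
    have "Im c * (t * (1 + Re c)) = - (Im c)\<^sup>2" 
      unfolding t by (simp add: power2_eq_square)
    also have "\<dots> = (Re c - 1) * (1 + Re c)"
      using sq by (simp add: algebra_simps power2_eq_square)
    finally have "(Im c * t) * (1 + Re c) = (Re c - 1) * (1 + Re c)" by (simp add: mult_ac)
    then have t1: "Im c * t = Re c - 1"
      using \<open>1 + Re c \<noteq> 0\<close> mult_right_cancel by blast
    have t2: "t + t * Re c = - Im c" using t by (simp add: algebra_simps)
    have eq: "X (Y (X z)) = c * z" for z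
    proof (rule complex_eqI)
      have "Re (X (Y (X z))) = Re z + t * Im z + t * (Im z + Im c * (Re z + t * Im z))"
        by (simp add: X_def Y_def)
      also have "\<dots> = Re z * (1 + Im c * t) + Im z * (t + t * (1 + Im c * t))"
        by (simp add: algebra_simps)
      also have "\<dots> = Re (c * z)" using t2 unfolding t1 by (simp add: algebra_simps)
      finally show "Re (X (Y (X z))) = Re (c * z)" .
      have "Im (X (Y (X z))) = Im c * Re z + (1 + Im c * t) * Im z"
        by (simp add: X_def Y_def algebra_simps)
      also have "\<dots> = Im (c * z)" unfolding t1 by simp
      finally show "Im (X (Y (X z))) = Im (c * z)" .
    qed
    have "(\<integral>\<^sup>+z. G (c * z) \<partial>lborel) = (\<integral>\<^sup>+z. G (X (Y (X z))) \<partial>lborel)" by (simp add: eq)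
    also have "\<dots> = (\<integral>\<^sup>+z. G (X (Y z)) \<partial>lborel)"
      by (rule nn_integral_shear_Re[of "\<lambda>z. G (X (Y z))" t, folded X_def]) measurable
    also have "\<dots> = (\<integral>\<^sup>+z. G (X z) \<partial>lborel)"
      by (rule nn_integral_shear_Im[of "\<lambda>z. G (X z)" "Im c", folded Y_def]) measurable
    also have "\<dots> = (\<integral>\<^sup>+z. G z \<partial>lborel)"
      by (rule nn_integral_shear_Re[of G t, folded X_def]) measurable
    finally show ?thesis .
  qed
  show ?thesis
  proof (cases "c = -1")
    case True
    have [measurable]: "F \<in> borel_measurable borel" by (rule F)
    \<comment> \<open>The half turn is two quarter turns, each covered by
      \<open>rot\<close>.\<close>
    have "(\<integral>\<^sup>+z. F (\<i> * (\<i> * z)) \<partial>lborel) = (\<integral>\<^sup>+z. F z \<partial>lborel)"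
      using rot[of "\<lambda>z. F (\<i> * z)" \<i>] rot[of F \<i>] by (simp add: complex_eq_iff)
    then show ?thesis by (simp add: True mult.assoc[symmetric])
  qed (use rot F c in auto)
qed

section \<open>Mean value inequalities for holomorphic functions\<close>

text \<open>Cauchy's formula on the unit circle for \<open>w\<close> \<mapsto>
  \<open>h (w * z)\<close>, followed by the triangle inequality for integrals. Rotating a fixed
  \<open>z\<close> keeps the radius implicit, covers \<open>z = 0\<close>, and fits the averaging
  over rotations.\<close>

lemma holomorphic_circle_mean_le:
  assumes h: "h holomorphic_on ball 0 R" and z: "cmod z < R"
  shows "ennreal (2 * pi * cmod (h 0)) \<le>
    (\<integral>\<^sup>+t. ennreal (cmod (h (cis t * z))) * indicator {0..2*pi} t \<partial>lborel)"
proof -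
  have sub: "w * z \<in> ball 0 R" if "cmod w \<le> 1" for w
    using z that mult_mono[of "cmod w" 1 "cmod z" "cmod z"] by (auto simp: norm_mult)
  have "(\<lambda>w. h (w * z)) holomorphic_on cball 0 1"
    by (rule holomorphic_on_compose_gen[of "\<lambda>w. w * z" _ h "ball 0 R", unfolded o_def])
      (use h sub in \<open>auto intro!: holomorphic_intros\<close>)
  from Cauchy_integral_circlepath_simple[OF this, of 0]
  have "((\<lambda>w. h (w * z) / w) has_contour_integral (2 * of_real pi * \<i> * h 0)) (circlepath 0 1)"
    by simp
  then have "((\<lambda>t. h (cis t * z) * \<i>) has_integral (2 * of_real pi * \<i> * h 0)) {0..2*pi}"
    unfolding circlepath_def by (subst (asm) has_contour_integral_part_circlepath_iff) auto
  then have I: "integral {0..2*pi} (\<lambda>t. h (cis t * z) * \<i>) = 2 * of_real pi * \<i> * h 0"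
    by (rule integral_unique)
  have "continuous_on {0..2*pi} (\<lambda>t. h (cis t * z) * \<i>)"
    by (intro continuous_on_mult continuous_on_const
        continuous_on_compose2[OF holomorphic_on_imp_continuous_on[OF h]] continuous_intros)
      (use sub in auto)
  then have si: "set_integrable lborel {0..2*pi} (\<lambda>t. h (cis t * z) * \<i>)"
    by (rule borel_integrable_atLeastAtMost')
  have "(LINT t|lborel. indicator {0..2*pi} t *\<^sub>R (h (cis t * z) * \<i>)) =
      2 * of_real pi * \<i> * h 0"
    using set_borel_integral_eq_integral(2)[OF si] unfolding I set_lebesgue_integral_def .
  then have "2 * pi * cmod (h 0) =
      norm (LINT t|lborel. indicator {0..2*pi} t *\<^sub>R (h (cis t * z) * \<i>))"
    by (simp only:) (simp add: norm_mult)
  also have "ennreal \<dots> \<le>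
      (\<integral>\<^sup>+t. norm (indicator {0..2*pi} t *\<^sub>R (h (cis t * z) * \<i>)) \<partial>lborel)"
    using si unfolding set_integrable_def by (rule integral_norm_bound_ennreal)
  also have "\<dots> = (\<integral>\<^sup>+t. ennreal (cmod (h (cis t * z))) * indicator {0..2*pi} t \<partial>lborel)"
    by (intro nn_integral_cong) (auto simp: indicator_def norm_mult)
  finally show ?thesis by simp
qed

lemma borel_measurable_ennreal_indicator:
  fixes g :: "complex \<Rightarrow> real"
  assumes "continuous_on S g" "open S"
  shows "(\<lambda>z. ennreal (g z) * indicator S z) \<in> borel_measurable borel"
proof -
  have "(\<lambda>z. indicator S z *\<^sub>R g z) \<in> borel_measurable borel"
    using borel_measurable_continuous_on_indicator[of S g] assms by auto
  then have "(\<lambda>z. ennreal (indicator S z *\<^sub>R g z)) \<in> borel_measurable borel"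
    by measurable
  also have "(\<lambda>z. ennreal (indicator S z *\<^sub>R g z)) = (\<lambda>z. ennreal (g z) * indicator S z)"
    by (auto simp: indicator_def)
  finally show ?thesis .
qed

text \<open>Averaging the area integral over all rotations of the disc replaces polar coordinates.\<close>

lemma holomorphic_area_mean_le:
  assumes h: "h holomorphic_on ball z0 r" and r: "0 < r"
  shows "ennreal (cmod (h z0) * (pi * r\<^sup>2)) \<le>
    (\<integral>\<^sup>+z. ennreal (cmod (h z)) * indicator (ball z0 r) z \<partial>lborel)"
proof -
  have h0: "(\<lambda>w. h (z0 + w)) holomorphic_on ball 0 r"
    by (rule holomorphic_on_compose_gen[of "\<lambda>w. z0 + w" _ h "ball z0 r", unfolded o_def])
      (use h in \<open>auto intro!: holomorphic_intros simp: dist_norm\<close>)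
  define F where "F w = ennreal (cmod (h (z0 + w))) * indicator (ball 0 r) w" for w
  have [measurable]: "F \<in> borel_measurable borel"
    unfolding F_def using holomorphic_on_imp_continuous_on[OF h0]
    by (intro borel_measurable_ennreal_indicator continuous_intros) auto
  have [measurable]: "cis \<in> borel_measurable borel"
    by (intro borel_measurable_continuous_onI continuous_intros)
  have Fcis: "F (cis t * w) = ennreal (cmod (h (z0 + cis t * w))) * indicator (ball 0 r) w" for t w
    by (auto simp: F_def indicator_def norm_mult)
  have "ennreal (2 * pi) * ennreal (cmod (h z0) * (pi * r\<^sup>2)) =
      (\<integral>\<^sup>+w. ennreal (2 * pi * cmod (h z0)) * indicator (ball 0 r) (w::complex) \<partial>lborel)"
    using r by (subst nn_integral_cmult_indicator)
      (auto simp: emeasure_ball unit_ball_vol_2 ennreal_mult[symmetric] mult_ac)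
  also have "\<dots> \<le> (\<integral>\<^sup>+w. \<integral>\<^sup>+t. F (cis t * w) * indicator {0..2*pi} t \<partial>lborel \<partial>lborel)"
  proof (rule nn_integral_mono)
    fix w :: complex
    show "ennreal (2 * pi * cmod (h z0)) * indicator (ball 0 r) w \<le>
      (\<integral>\<^sup>+t. F (cis t * w) * indicator {0..2*pi} t \<partial>lborel)"
      using holomorphic_circle_mean_le[OF h0, of w]
      by (auto simp: Fcis indicator_def cong: nn_integral_cong)
  qed
  \<comment> \<open>After the swap the inner integral is independent of \<open>t\<close> by rotation
    invariance, so the factor 2\<pi> appears on both sides and cancels.\<close>
  also have "\<dots> = (\<integral>\<^sup>+t. \<integral>\<^sup>+w. F (cis t * w) * indicator {0..2*pi} t \<partial>lborel \<partial>lborel)"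
    by (rule lborel_pair.Fubini') measurable
  also have "\<dots> = (\<integral>\<^sup>+t. (\<integral>\<^sup>+w. F w \<partial>lborel) * indicator {0..2*pi} t \<partial>lborel)"
    by (intro nn_integral_cong, subst nn_integral_multc)
      (auto simp: nn_integral_rotation)
  also have "\<dots> = ennreal (2 * pi) * (\<integral>\<^sup>+w. F w \<partial>lborel)"
    by (subst nn_integral_cmult_indicator) (auto simp: mult.commute)
  finally have "ennreal (cmod (h z0) * (pi * r\<^sup>2)) \<le> (\<integral>\<^sup>+w. F w \<partial>lborel)"
    by (simp add: ennreal_mult_le_mult_iff)
  also have "\<dots> = (\<integral>\<^sup>+z. ennreal (cmod (h z)) * indicator (ball z0 r) z \<partial>lborel)"
  proof -
    have [measurable]: "(\<lambda>z. ennreal (cmod (h z)) * indicator (ball z0 r) z) \<in> borel_measurable borel"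
      using holomorphic_on_imp_continuous_on[OF h]
      by (intro borel_measurable_ennreal_indicator continuous_intros) auto
    have "F = (\<lambda>w. ennreal (cmod (h (z0 + w))) * indicator (ball z0 r) (z0 + w))"
      by (auto simp: F_def indicator_def dist_norm)
    then show ?thesis
      using nn_integral_lborel_translation
        [of "\<lambda>z. ennreal (cmod (h z)) * indicator (ball z0 r) z" z0] by simp
  qed
  finally show ?thesis .
qed


section \<open>Sub-mean value property of the hyperbolic density\<close>

text \<open>The difference of the two sides is exactly |a - w|^2.\<close>

lemma one_minus_cnj_mult_ge:
  "(1 - (cmod a)\<^sup>2) * (1 - (cmod w)\<^sup>2) \<le> (cmod (1 - cnj a * w))\<^sup>2"
proof -
  have "(cmod (1 - cnj a * w))\<^sup>2 - (1 - (cmod a)\<^sup>2) * (1 - (cmod w)\<^sup>2) = (cmod (a - w))\<^sup>2"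
    by (simp add: cmod_power2) (simp add: power2_eq_square algebra_simps)
  then show ?thesis by (metis diff_ge_0_iff_ge zero_le_power2)
qed

text \<open>The function u of the opening remarks: on the disc, the density of the hyperbolic area
  form pulled back by \<open>f\<close>.\<close>

definition hyp_density :: "(complex \<Rightarrow> complex) \<Rightarrow> complex \<Rightarrow> real" where
  "hyp_density f z = (cmod (deriv f z))\<^sup>2 * (lambda_H (f z))\<^sup>2"

lemma lambda_H_pos: "z \<in> ball 0 1 \<Longrightarrow> 0 < lambda_H z"
  by (simp add: lambda_H_def abs_square_less_1)

lemma continuous_on_lambda_H: "continuous_on (ball 0 1) lambda_H"
proof -
  have "1 - (cmod z)\<^sup>2 \<noteq> 0" if "z \<in> ball 0 1" for z
    using lambda_H_pos[OF that] by (auto simp: lambda_H_def)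
  then show ?thesis
    unfolding lambda_H_def by (intro continuous_intros) auto
qed

text \<open>With \<open>a = f(z\<^sub>0)\<close>, the holomorphic function
  \<open>h = (2 f' (1 - |a|\<^sup>2) / (1 - a\<^sup>* f)\<^sup>2)\<^sup>2\<close> (where \<open>a\<^sup>*\<close> is the conjugate) satisfies \<open>|h| \<le> u\<close> with
  equality at \<open>z\<^sub>0\<close>; it is \<open>(2F')\<^sup>2\<close> for \<open>F\<close> the composition of \<open>f\<close> with the disc automorphism
  taking \<open>a\<close> to \<open>0\<close>.\<close>

lemma hyp_density_mean_le:
  assumes f: "f holomorphic_on ball 0 1" "f ` ball 0 1 \<subseteq> ball 0 1"
    and r: "0 < r" "ball z0 r \<subseteq> ball 0 1"
  shows "ennreal (hyp_density f z0 * (pi * r\<^sup>2)) \<le>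
    (\<integral>\<^sup>+z. ennreal (hyp_density f z) * indicator (ball z0 r) z \<partial>lborel)"
proof -
  define a where "a = f z0"
  define b where "b = 1 - (cmod a)\<^sup>2"
  have z0: "z0 \<in> ball 0 1" using r by (meson centre_in_ball subsetD)
  have f1: "cmod (f z) < 1" if "z \<in> ball 0 1" for z
    using f(2) that by (auto simp: image_subset_iff)
  have a: "cmod a < 1" unfolding a_def by (rule f1[OF z0])
  then have b: "0 < b" by (simp add: b_def abs_square_less_1)
  have nz: "1 - cnj a * f z \<noteq> 0" if "z \<in> ball 0 1" for z
  proof
    assume "1 - cnj a * f z = 0"
    then have "cmod a * cmod (f z) = 1"
      by (metis complex_mod_cnj eq_iff_diff_eq_0 norm_mult norm_one)
    then show False
      using mult_strict_mono'[of "cmod a" 1 "cmod (f z)" 1] a f1[OF that] by simp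
  qed
  \<comment> \<open>The outer square makes |h| quadratic in |f'|, as the density is, while
    \<open>h\<close> stays holomorphic.\<close>
  define h where "h z = (2 * deriv f z * of_real b / (1 - cnj a * f z)\<^sup>2)\<^sup>2" for z
  have hn: "cmod (h z) = (cmod (deriv f z))\<^sup>2 * (2 * b / (cmod (1 - cnj a * f z))\<^sup>2)\<^sup>2" for z
    using b by (simp add: h_def norm_mult norm_divide norm_power power_mult_distrib power_divide)
  have "h holomorphic_on ball 0 1"
    unfolding h_def using f(1) nz by (intro holomorphic_intros) auto
  then have "h holomorphic_on ball z0 r"
    using r(2) by (rule holomorphic_on_subset)
  from holomorphic_area_mean_le[OF this r(1)]
  have "ennreal (cmod (h z0) * (pi * r\<^sup>2)) \<le>
    (\<integral>\<^sup>+z. ennreal (cmod (h z)) * indicator (ball z0 r) z \<partial>lborel)" .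
  also have "cmod (h z0) = hyp_density f z0"
  proof -
    have "1 - cnj a * f z0 = of_real b"
      using complex_norm_square[of a] by (simp add: b_def a_def mult.commute)
    moreover have "lambda_H (f z0) = 2 / b" by (simp add: lambda_H_def a_def b_def)
    ultimately have "2 * b / (cmod (1 - cnj a * f z0))\<^sup>2 = lambda_H (f z0)"
      using b by (simp add: power2_eq_square)
    then show ?thesis by (simp add: hn hyp_density_def)
  qed
  also have "(\<integral>\<^sup>+z. ennreal (cmod (h z)) * indicator (ball z0 r) z \<partial>lborel) \<le>
      (\<integral>\<^sup>+z. ennreal (hyp_density f z) * indicator (ball z0 r) z \<partial>lborel)"
  proof (rule nn_integral_mono)
    fix z
    have "cmod (h z) \<le> hyp_density f z" if z: "z \<in> ball 0 1"
    proof -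
      have "0 < 1 - (cmod (f z))\<^sup>2" using f1[OF z] by (simp add: abs_square_less_1)
      moreover have "b * (1 - (cmod (f z))\<^sup>2) \<le> (cmod (1 - cnj a * f z))\<^sup>2"
        unfolding b_def by (rule one_minus_cnj_mult_ge)
      ultimately have "2 * b / (cmod (1 - cnj a * f z))\<^sup>2 \<le> lambda_H (f z)"
        using nz[OF z] by (simp add: lambda_H_def divide_simps)
      then show ?thesis
        unfolding hn hyp_density_def using b by (intro mult_left_mono power_mono) auto
    qed
    then show "ennreal (cmod (h z)) * indicator (ball z0 r) z \<le>
        ennreal (hyp_density f z) * indicator (ball z0 r) z"
      using subsetD[OF r(2)] by (auto simp: indicator_def simp del: mem_ball intro: ennreal_leI)
  qed
  finally show ?thesis .
qed

section \<open>Discs centred on the ray\<close>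

text \<open>The left side is the radius of the disc around \<gamma>(t); this form turns a comparison
  of radii into one of exponentials.\<close>

lemma one_minus_tanh_half: "(1 - tanh (t/2)) / 2 = 1 / (exp t + 1)" for t :: real
proof -
  have "exp t * exp (-t) = 1" by (simp add: exp_minus)
  moreover have "1 + exp t \<noteq> 0" "1 + exp (-t) \<noteq> 0"
    by (smt (verit) exp_gt_zero)+
  ultimately show ?thesis
    by (simp add: tanh_real_altdef field_simps)
qed

lemma norm_cis_minus_radial:
  "0 \<le> t \<Longrightarrow> cmod (cis \<theta> - of_real (tanh (t/2)) * cis \<theta>) = 1 - tanh (t/2)"
proof -
  have "cis \<theta> - of_real (tanh (t/2)) * cis \<theta> = of_real (1 - tanh (t/2)) * cis \<theta>"
    by (simp add: algebra_simps)
  then show ?thesis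
    using tanh_real_lt_1[of "t/2"] by (simp add: norm_mult del: of_real_diff)
qed

text \<open>Measured by the distance \<open>x\<close> to the endpoint of the ray: \<open>z \<in> B\<^sub>t\<close> forces
  \<open>(1 - |\<gamma>(t)|)/2 < x < 3(1 - |\<gamma>(t)|)/2\<close>.\<close>

lemma radial_balls_hitting_time:
  assumes "0 \<le> s" "0 \<le> t"
    and "z \<in> ball (of_real (tanh (s/2)) * cis \<theta>) ((1 - tanh (s/2)) / 2)"
    and "z \<in> ball (of_real (tanh (t/2)) * cis \<theta>) ((1 - tanh (t/2)) / 2)"
  shows "s \<le> t + ln 5"
proof -
  define x where "x = cmod (cis \<theta> - z)"
  have bd: "(1 - tanh (q/2)) / 2 < x \<and> x < 3 * ((1 - tanh (q/2)) / 2)"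
    if "0 \<le> q" "z \<in> ball (of_real (tanh (q/2)) * cis \<theta>) ((1 - tanh (q/2)) / 2)" for q
    using norm_cis_minus_radial[OF that(1), of \<theta>] that(2)
      norm_triangle_ineq4[of "cis \<theta> - z" "of_real (tanh (q/2)) * cis \<theta> - z"]
      norm_triangle_ineq[of "cis \<theta> - of_real (tanh (q/2)) * cis \<theta>" "of_real (tanh (q/2)) * cis \<theta> - z"]
    by (simp add: x_def dist_norm field_simps)
  \<comment> \<open>The lower bound on \<open>x\<close> at time \<open>t\<close> meets the upper
    bound at time \<open>s\<close>.\<close>
  have "(1 - tanh (t/2)) / 2 < 3 * ((1 - tanh (s/2)) / 2)"
    using bd[of s] bd[of t] assms by linarith
  then have "1 / (exp t + 1) < 3 * (1 / (exp s + 1))"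
    unfolding one_minus_tanh_half .
  then have "exp s < 3 * exp t + 2"
    by (simp add: divide_simps add_pos_pos algebra_simps split: if_splits)
  \<comment> \<open>Since \<open>exp t\<close> is at least 1, it absorbs the constant 2; this is the
    source of ln 5.\<close>
  also have "\<dots> \<le> 5 * exp t" using assms(2) by simp
  also have "\<dots> = exp (t + ln 5)" by (simp add: exp_add)
  finally show ?thesis by simp
qed

text \<open>Any two times whose discs contain \<open>z\<close> differ by at most ln 5, so all of
  them lie within ln 5 of any single one.\<close>

lemma nn_integral_radial_kernel_le:
  "(\<integral>\<^sup>+t. indicator {0..} t *
      indicator (ball (of_real (tanh (t/2)) * cis \<theta>) ((1 - tanh (t/2)) / 2)) z \<partial>lborel)
    \<le> ennreal (2 * ln 5)"
proof -
  define S where "S = {t. 0 \<le> t \<and>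
    z \<in> ball (of_real (tanh (t/2)) * cis \<theta>) ((1 - tanh (t/2)) / 2)}"
  have S: "indicator {0..} t *
      indicator (ball (of_real (tanh (t/2)) * cis \<theta>) ((1 - tanh (t/2)) / 2)) z =
      (indicator S t :: ennreal)" for t
    by (auto simp: S_def indicator_def)
  show ?thesis
  proof (cases "S = {}")
    case True
    then show ?thesis by (simp only: S) simp
  next
    case False
    then obtain t0 where t0: "t0 \<in> S" by blast
    have "S \<subseteq> {t0 - ln 5..t0 + ln 5}"
      using radial_balls_hitting_time[of _ t0 z \<theta>] radial_balls_hitting_time[of t0 _ z \<theta>] t0
      by (fastforce simp: S_def)
    then have "(\<integral>\<^sup>+t. indicator S t \<partial>lborel) \<le> (\<integral>\<^sup>+t. indicator {t0 - ln 5..t0 + ln 5} t \<partial>lborel)"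
      by (intro nn_integral_mono) (auto simp: indicator_def)
    also have "\<dots> = ennreal (2 * ln 5)" by simp
    finally show ?thesis unfolding S .
  qed
qed

section \<open>Square integrability of the hyperbolic derivative along the ray\<close>

lemma hyp_deriv_norm_square:
  "(hyp_deriv_norm f z)\<^sup>2 = hyp_density f z / (lambda_H z)\<^sup>2"
  by (simp add: hyp_deriv_norm_def hyp_density_def power_mult_distrib power_divide)

lemma radial_in_ball: "of_real (tanh (t/2)) * cis \<theta> \<in> ball 0 1" for t :: real
  using tanh_real_bounds[of "t/2"] by (auto simp: norm_mult)

lemma continuous_on_hyp_deriv_norm:
  assumes f: "f holomorphic_on ball 0 1" "f ` ball 0 1 \<subseteq> ball 0 1"
  shows "continuous_on (ball 0 1) (hyp_deriv_norm f)"
  unfolding hyp_deriv_norm_def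
  using f(2) lambda_H_pos continuous_on_lambda_H
    holomorphic_on_imp_continuous_on[OF holomorphic_deriv[OF f(1) open_ball]]
    holomorphic_on_imp_continuous_on[OF f(1)]
  by (intro continuous_intros continuous_on_compose2[OF continuous_on_lambda_H, of _ f]) force+

lemma continuous_on_hyp_density:
  assumes f: "f holomorphic_on ball 0 1" "f ` ball 0 1 \<subseteq> ball 0 1"
  shows "continuous_on (ball 0 1) (hyp_density f)"
  unfolding hyp_density_def
  using f(2) holomorphic_on_imp_continuous_on[OF holomorphic_deriv[OF f(1) open_ball]]
    holomorphic_on_imp_continuous_on[OF f(1)]
  by (intro continuous_intros continuous_on_compose2[OF continuous_on_lambda_H, of _ f])

text \<open>The argument bounds the integral by (4/\<pi>) * 2 ln 5 times the hyperbolic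
  area.\<close>

lemma nn_integral_radial_hyp_deriv_norm_finite:
  assumes f: "f holomorphic_on ball 0 1" "f ` ball 0 1 \<subseteq> ball 0 1"
    and A: "hyp_area_image f < \<infinity>"
  shows "(\<integral>\<^sup>+t. indicator {0..} t *
      ennreal ((hyp_deriv_norm f (of_real (tanh (t/2)) * cis \<theta>))\<^sup>2) \<partial>lborel) < \<infinity>"
proof -
  define \<gamma> where "\<gamma> t = complex_of_real (tanh (t/2)) * cis \<theta>" for t
  define \<sigma> :: "real \<Rightarrow> real" where "\<sigma> t = 1 - tanh (t/2)" for t
  define U where "U z = ennreal (hyp_density f z) * indicator (ball 0 1) z" for z
  have [measurable]: "U \<in> borel_measurable borel"
    unfolding U_def
    by (intro borel_measurable_ennreal_indicator continuous_on_hyp_density f open_ball)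
  have [measurable]: "\<gamma> \<in> borel_measurable borel" "\<sigma> \<in> borel_measurable borel"
    unfolding \<gamma>_def \<sigma>_def
    by (intro borel_measurable_continuous_onI continuous_intros; simp)+
  have \<sigma>: "0 < \<sigma> t" for t using tanh_real_lt_1[of "t/2"] by (simp add: \<sigma>_def)
  \<comment> \<open>Here |\<gamma>(t)| = 1 - \<sigma>(t), so points of the disc have modulus below 1
    - \<sigma>(t)/2.\<close>
  have sub: "ball (\<gamma> t) (\<sigma> t / 2) \<subseteq> ball 0 1" if "0 \<le> t" for t
  proof
    fix z assume "z \<in> ball (\<gamma> t) (\<sigma> t / 2)"
    moreover have "cmod (\<gamma> t) = 1 - \<sigma> t" using that by (simp add: \<gamma>_def \<sigma>_def norm_mult)
    ultimately show "z \<in> ball 0 1"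
      using norm_triangle_sub[of z "\<gamma> t"] \<sigma>[of t] by (simp add: dist_norm norm_minus_commute)
  qed
  have pt: "indicator {0..} t * ennreal ((hyp_deriv_norm f (\<gamma> t))\<^sup>2) \<le>
      (\<integral>\<^sup>+z. ennreal (4/pi) * (U z * (indicator {0..} t * indicator (ball (\<gamma> t) (\<sigma> t / 2)) z)) \<partial>lborel)"
    for t
  proof (cases "0 \<le> t")
    case True
    \<comment> \<open>Thus 1/\<lambda> is \<sigma>(t) times a factor at most 1, and \<sigma>(t)^2 is
      4/\<pi> times the area of the disc of radius \<sigma>(t)/2.\<close>
    have "lambda_H (\<gamma> t) = 2 / (\<sigma> t * (1 + tanh (t/2)))"
      using True by (simp add: lambda_H_def \<gamma>_def \<sigma>_def norm_mult power2_eq_square algebra_simps)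
    then have "(hyp_deriv_norm f (\<gamma> t))\<^sup>2 = hyp_density f (\<gamma> t) * (\<sigma> t * ((1 + tanh (t/2)) / 2))\<^sup>2"
      by (simp add: hyp_deriv_norm_square power_divide power_mult_distrib)
    also have "\<dots> \<le> hyp_density f (\<gamma> t) * (\<sigma> t * 1)\<^sup>2"
      using \<sigma>[of t] True tanh_real_lt_1[of "t/2"]
      by (intro mult_left_mono power_mono) (auto simp: hyp_density_def)
    also have "\<dots> = 4/pi * (hyp_density f (\<gamma> t) * (pi * (\<sigma> t / 2)\<^sup>2))"
      by (simp add: power_divide)
    finally have "ennreal ((hyp_deriv_norm f (\<gamma> t))\<^sup>2) \<le>
        ennreal (4/pi * (hyp_density f (\<gamma> t) * (pi * (\<sigma> t / 2)\<^sup>2)))"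
      by (rule ennreal_leI)
    also have "\<dots> = ennreal (4/pi) * ennreal (hyp_density f (\<gamma> t) * (pi * (\<sigma> t / 2)\<^sup>2))"
      by (subst ennreal_mult') simp_all
    also have "\<dots> \<le> ennreal (4/pi) *
        (\<integral>\<^sup>+z. ennreal (hyp_density f z) * indicator (ball (\<gamma> t) (\<sigma> t / 2)) z \<partial>lborel)"
      using \<sigma>[of t] sub[OF True] by (intro mult_left_mono hyp_density_mean_le f) auto
    also have "\<dots> = ennreal (4/pi) * (\<integral>\<^sup>+z. U z * indicator (ball (\<gamma> t) (\<sigma> t / 2)) z \<partial>lborel)"
      using subsetD[OF sub[OF True]]
      by (intro arg_cong[where f="(*) _"] nn_integral_cong)
        (auto simp: U_def indicator_def simp del: mem_ball)
    also have "\<dots> = (\<integral>\<^sup>+z. ennreal (4/pi) * (U z * indicator (ball (\<gamma> t) (\<sigma> t / 2)) z) \<partial>lborel)"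
      by (intro nn_integral_cmult[symmetric] borel_measurable_times_ennreal
          borel_measurable_indicator) auto
    finally show ?thesis using True by simp
  qed simp
  have "(\<integral>\<^sup>+t. indicator {0..} t * ennreal ((hyp_deriv_norm f (\<gamma> t))\<^sup>2) \<partial>lborel) \<le>
    (\<integral>\<^sup>+t. \<integral>\<^sup>+z. ennreal (4/pi) * (U z * (indicator {0..} t * indicator (ball (\<gamma> t) (\<sigma> t / 2)) z))
      \<partial>lborel \<partial>lborel)"
    by (intro nn_integral_mono pt)
  also have "\<dots> = (\<integral>\<^sup>+z. \<integral>\<^sup>+t. ennreal (4/pi) * (U z * (indicator {0..} t * indicator (ball (\<gamma> t) (\<sigma> t / 2)) z))
      \<partial>lborel \<partial>lborel)"
    \<comment> \<open>Joint measurability comes from unfolding disc membership to an inequality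
      between distance and radius.\<close>
    by (rule lborel_pair.Fubini') (simp add: ball_def indicator_def split_beta')
  also have "\<dots> = (\<integral>\<^sup>+z. ennreal (4/pi) * (U z * (\<integral>\<^sup>+t. indicator {0..} t * indicator (ball (\<gamma> t) (\<sigma> t / 2)) z
      \<partial>lborel)) \<partial>lborel)"
    by (simp add: nn_integral_cmult ball_def indicator_def)
  also have "\<dots> \<le> (\<integral>\<^sup>+z. ennreal (4/pi) * (U z * ennreal (2 * ln 5)) \<partial>lborel)"
    unfolding \<gamma>_def \<sigma>_def
    by (intro nn_integral_mono mult_left_mono nn_integral_radial_kernel_le) auto
  also have "\<dots> = ennreal (4/pi) * (hyp_area_image f * ennreal (2 * ln 5))"
  proof -
    have "hyp_area_image f = (\<integral>\<^sup>+z. U z \<partial>lborel)"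
      by (simp add: hyp_area_image_def U_def hyp_density_def)
    then show ?thesis by (simp add: nn_integral_cmult nn_integral_multc)
  qed
  also have "\<dots> < \<infinity>"
    using A by (simp add: ennreal_mult_less_top)
  finally show ?thesis by (simp add: \<gamma>_def)
qed


section \<open>From square integrability to little-o growth\<close>

text \<open>From some \<open>T\<close> on, \<open>G\<close> is within \<open>e\<close> of its
  supremum. Applied to the integral of g^2 over [0, t], this makes the tail small.\<close>

lemma mono_bounded_tail_small:
  fixes G :: "real \<Rightarrow> real"
  assumes mono: "\<And>s t. 0 \<le> s \<Longrightarrow> s \<le> t \<Longrightarrow> G s \<le> G t" and bdd: "\<And>t. 0 \<le> t \<Longrightarrow> G t \<le> B"
    and e: "0 < e"
  obtains T where "0 \<le> T" "\<And>t. T \<le> t \<Longrightarrow> G t - G T < e"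
proof -
  have bd: "bdd_above (G ` {0..})" using bdd by (auto intro!: bdd_aboveI)
  have "Sup (G ` {0..}) - e < Sup (G ` {0..})" using e by simp
  then obtain T where T: "0 \<le> T" "Sup (G ` {0..}) - e < G T"
    using less_cSup_iff[OF _ bd] by auto
  show ?thesis
  proof
    show "G t - G T < e" if "T \<le> t" for t
      using cSup_upper[OF _ bd, of "G t"] T that by force
  qed (rule T)
qed

text \<open>Cauchy-Schwarz on \<open>[T, \<rho>]\<close>, in the form \<open>g \<le> a/2 + g\<^sup>2/(2a)\<close> with \<open>a = \<epsilon> / \<surd>\<rho>\<close>.\<close>

lemma integral_smallo_sqrt:
  fixes g :: "real \<Rightarrow> real"
  assumes cont: "continuous_on {0..} g" and nonneg: "\<And>t. 0 \<le> t \<Longrightarrow> 0 \<le> g t"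
    and fin: "(\<integral>\<^sup>+t. indicator {0..} t * ennreal ((g t)\<^sup>2) \<partial>lborel) < \<infinity>"
  shows "(\<lambda>\<rho>. integral {0..\<rho>} g) \<in> o[at_top](sqrt)"
proof (rule landau_o.smallI)
  fix c :: real assume c: "0 < c"
  have int: "g integrable_on {a..b}" "(\<lambda>t. (g t)\<^sup>2) integrable_on {a..b}" if "0 \<le> a" for a b
    using that by (auto intro!: integrable_continuous_interval continuous_intros
        intro: continuous_on_subset[OF cont])
  define G where "G t = integral {0..t} (\<lambda>t. (g t)\<^sup>2)" for t
  define N where "N = (\<integral>\<^sup>+t. indicator {0..} t * ennreal ((g t)\<^sup>2) \<partial>lborel)"
  have split: "G t = G s + integral {s..t} (\<lambda>t. (g t)\<^sup>2)" if "0 \<le> s" "s \<le> t" for s t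
    unfolding G_def using that int(2)[of 0 t]
    by (simp add: Henstock_Kurzweil_Integration.integral_combine)
  have mono: "G s \<le> G t" if "0 \<le> s" "s \<le> t" for s t
    using split[OF that] integral_nonneg[OF int(2)[OF that(1)], of t] by simp
  \<comment> \<open>The gauge integral \<open>G t\<close> is compared with the nonnegative Lebesgue
    integral \<open>N\<close> by way of set integrability.\<close>
  have bdd: "G t \<le> enn2real N" if "0 \<le> t" for t
  proof -
    have si: "set_integrable lborel {0..t} (\<lambda>t. (g t)\<^sup>2)"
      by (intro borel_integrable_atLeastAtMost' continuous_intros continuous_on_subset[OF cont]) auto
    have "ennreal (G t) = ennreal (LINT x|lborel. indicator {0..t} x *\<^sub>R (g x)\<^sup>2)"
      using set_borel_integral_eq_integral(2)[OF si] by (simp add: G_def set_lebesgue_integral_def)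
    also have "\<dots> = (\<integral>\<^sup>+x. ennreal (indicator {0..t} x *\<^sub>R (g x)\<^sup>2) \<partial>lborel)"
      using si unfolding set_integrable_def by (intro nn_integral_eq_integral[symmetric]) auto
    also have "\<dots> \<le> N"
      unfolding N_def by (intro nn_integral_mono) (auto simp: indicator_def)
    finally show ?thesis
      using fin by (metis N_def enn2real_leI enn2real_nonneg ennreal_enn2real ennreal_le_iff infinity_ennreal_def)
  qed
  obtain T where T: "0 \<le> T" "\<And>t. T \<le> t \<Longrightarrow> G t - G T < (c/2)\<^sup>2"
    using mono_bounded_tail_small[of G "enn2real N" "(c/2)\<^sup>2"] mono bdd c
    by (metis half_gt_zero zero_less_power)
  \<comment> \<open>The part over [0, T] is a constant and takes half of the allowance
    \<open>c\<close>; the tail takes the other half.\<close>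
  have "eventually (\<lambda>\<rho>. integral {0..T} g \<le> c/2 * sqrt \<rho>) at_top"
    using eventually_ge_at_top[of "(integral {0..T} g / (c/2))\<^sup>2"]
  proof eventually_elim
    case (elim \<rho>)
    then have "integral {0..T} g / (c/2) \<le> sqrt \<rho>" by (rule real_le_rsqrt)
    then show ?case using c by (simp add: field_simps)
  qed
  then show "eventually (\<lambda>\<rho>. norm (integral {0..\<rho>} g) \<le> c * norm (sqrt \<rho>)) at_top"
    using eventually_gt_at_top[of "T + 1"]
  proof eventually_elim
    case (elim \<rho>)
    then have \<rho>: "0 < \<rho>" "T \<le> \<rho>" using T(1) by auto
    define a where "a = c / 2 / sqrt \<rho>"
    have a: "0 < a" using c \<rho> by (simp add: a_def)
    have amgm: "g t \<le> a/2 + (g t)\<^sup>2 / (2*a)" for t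
      using zero_le_power2[of "g t - a"] a by (simp add: field_simps power2_eq_square)
    have "integral {T..\<rho>} g \<le> integral {T..\<rho>} (\<lambda>t. a/2 + (g t)\<^sup>2 / (2*a))"
      using int[OF T(1), of \<rho>] amgm by (intro integral_le integrable_add integrable_on_divide) auto
    also have "\<dots> = a/2 * (\<rho> - T) + (G \<rho> - G T) / (2*a)"
      using int[OF T(1), of \<rho>] \<rho> split[OF T(1) \<rho>(2)]
      by (subst integral_add) (auto intro!: integrable_on_divide)
    \<comment> \<open>By the choice of \<open>a\<close>, both summands on the right equal (c/4) sqrt
      \<rho>.\<close>
    also have "\<dots> \<le> a/2 * \<rho> + (c/2)\<^sup>2 / (2*a)"
      using a T(1) T(2)[OF \<rho>(2)] by (intro add_mono mult_left_mono divide_right_mono) auto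
    also have "\<dots> = c/2 * sqrt \<rho>"
    proof -
      have "\<rho> = sqrt \<rho> * sqrt \<rho>" using \<rho> by simp
      then have "a * \<rho> = c/2 * sqrt \<rho>" using \<rho> by (simp add: a_def field_simps)
      moreover have "(c/2)\<^sup>2 / a = c/2 * sqrt \<rho>"
        using c \<rho> by (simp add: a_def power2_eq_square)
      ultimately show ?thesis by (simp add: field_simps)
    qed
    finally have "integral {T..\<rho>} g \<le> c/2 * sqrt \<rho>" .
    moreover have "integral {0..\<rho>} g = integral {0..T} g + integral {T..\<rho>} g"
      using T(1) \<rho> int(1)[of 0 \<rho>] by (simp add: Henstock_Kurzweil_Integration.integral_combine)
    moreover have "0 \<le> integral {0..\<rho>} g"
      using int(1)[of 0 \<rho>] nonneg by (intro integral_nonneg) auto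
    ultimately show ?case using elim \<rho> by (simp add: field_simps)
  qed
qed

theorem theorem3p2:
  fixes f :: "complex \<Rightarrow> complex" and \<theta> :: real
  assumes "f holomorphic_on ball 0 1"
    and "f ` ball 0 1 \<subseteq> ball 0 1"
    and "hyp_area_image f < \<infinity>"
  shows "(\<lambda>\<rho>. L_H f \<theta> \<rho>) \<in> o[at_top](\<lambda>\<rho>. sqrt \<rho>)"
  unfolding L_H_def
proof (rule integral_smallo_sqrt)
  show "continuous_on {0..} (\<lambda>t. hyp_deriv_norm f (of_real (tanh (t/2)) * cis \<theta>))"
    by (rule continuous_on_compose2[OF continuous_on_hyp_deriv_norm[OF assms(1,2)]])
      (use radial_in_ball in \<open>auto intro!: continuous_intros\<close>)
  show "0 \<le> hyp_deriv_norm f (of_real (tanh (t/2)) * cis \<theta>)" for t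
  proof -
    \<comment> \<open>\<open>lambda_H\<close> is negative outside the closed disc, so the sign is
      settled by locating both the point and its image in the disc.\<close>
    have "f (of_real (tanh (t/2)) * cis \<theta>) \<in> ball 0 1"
      using assms(2) radial_in_ball by blast
    then show ?thesis
      unfolding hyp_deriv_norm_def
      by (intro divide_nonneg_pos mult_nonneg_nonneg norm_ge_zero less_imp_le[OF lambda_H_pos]
          lambda_H_pos radial_in_ball)
  qed
qed (rule nn_integral_radial_hyp_deriv_norm_finite[OF assms])

end
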